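(* Let $g(z)=z+\sum_{n\ge 2}g_nz^n\in\mathbb{A}$, write $[n]_g=g_n$, and let $\phi(z)=1+B_1z+B_2z^2+\cdots$ be as in the context. If $f(z)=z+\sum_{n\ge2}a_nz^n\in\mathbb{A}$ belongs to $\mathcal{C}_g(\phi)$, then the Hankel determinant $\mathcal{H}_2(1)=\begin{vmatrix} 1 & a_2 \\ a_2 & a_3 \end{vmatrix}=a_3-a_2^2$ satisfies $$|\mathcal{H}_2(1)|\le\frac{B_1}{[3]_g([3]_g-1)}\max\left\{1,\left|\frac{B_2}{B_1}+\frac{B_1}{[2]_g-1}\left(1-\frac{[3]_g([3]_g-1)}{[2]_g^2([2]_g-1)}\right)\right|\right\}.$$
   Context: $\mathbb{U}=\{z\in\mathbb{C}:|z|<1\}$, and $\mathbb{A}$ is the set of analytic functions $f$ on $\mathbb{U}$ with $f(0)=0$, $f'(0)=1$, i.e. $f(z)=z+\sum_{n\ge2}a_nz^n$. For analytic $F,\phi$ on $\mathbb{U}$, $F\prec\phi$ (subordination) means there is an analytic $u$ on $\mathbb{U}$ with $u(0)=0$, $|u(z)|<1$ and $F(z)=\phi(u(z))$ for all $z\in\mathbb{U}$. For $g(z)=z+\sum_{n\ge2}g_nz^n\in\mathbb{A}$, the $g$-derivative of $f\in\mathbb{A}$ is $D_gf(z)=\frac1z\left(z+\sum_{n\ge2}[n]_ga_nz^n\right)$, where $[n]_g=g_n$ (so $zD_gf\in\mathbb{A}$ is the convolution, i.e. Hadamard product, of $f$ and $g$). The function $\phi$ is analytic on $\mathbb{U}$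 with positive real part, $\phi(0)=1$, $\phi'(0)>0$, $\phi(\mathbb{U})$ symmetric with respect to the real axis, with expansion $\phi(z)=1+B_1z+B_2z^2+B_3z^3+\cdots$, $B_1>0$. The class $\mathcal{C}_g(\phi)$ consists of all $f\in\mathbb{A}$ such that $\frac{D_g(zD_gf(z))}{D_gf(z)}\prec\phi(z)$.
   Formalization: The prefactor is B_1/|[3]_g([3]_g-1)| instead of B_1/([3]_g([3]_g-1)), since the printed bound fails for f(z)=z when 0<[3]_g<1; [2]_g and [3]_g are assumed different from 0 and 1 so that the denominators do not vanish. *)

theory Defs
  imports "HOL-Complex_Analysis.Complex_Analysis"
begin

abbreviation unit_disc :: "complex set" ("\<U>") where
  "\<U> \<equiv> ball 0 1"

abbreviation tcoeff :: "(complex \<Rightarrow> complex) \<Rightarrow> nat \<Rightarrow> complex" where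
  "tcoeff f n \<equiv> fps_nth (fps_expansion f 0) n"

definition class_A :: "(complex \<Rightarrow> complex) set" where
  "class_A = {f. f holomorphic_on \<U> \<and> f 0 = 0 \<and> deriv f 0 = 1}"

definition subordinate :: "(complex \<Rightarrow> complex) \<Rightarrow> (complex \<Rightarrow> complex) \<Rightarrow> bool"
    (infix "\<prec>\<^sub>s" 50) where
  "F \<prec>\<^sub>s \<phi> \<longleftrightarrow> (\<exists>u. u holomorphic_on \<U> \<and> u 0 = 0 \<and>
     (\<forall>z\<in>\<U>. cmod (u z) < 1 \<and> F z = \<phi> (u z)))"

text \<open>The factor \<open>1/z\<close> of the \<open>g\<close>-derivative is cancelled termwise, so that the value at
  \<open>z = 0\<close> is the limit \<open>1\<close>; the summation index is shifted by two.\<close>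

definition g_deriv :: "(complex \<Rightarrow> complex) \<Rightarrow> (complex \<Rightarrow> complex) \<Rightarrow> complex \<Rightarrow> complex" where
  "g_deriv g f z = 1 + (\<Sum>n. tcoeff g (n + 2) * tcoeff f (n + 2) * z ^ (n + 1))"

text \<open>Univalence of \<open>\<phi>\<close> is not required, and hence the higher coefficients of \<open>\<phi>\<close> may be complex.\<close>

definition admissible_phi :: "(complex \<Rightarrow> complex) \<Rightarrow> bool" where
  "admissible_phi \<phi> \<longleftrightarrow> \<phi> holomorphic_on \<U> \<and> (\<forall>z\<in>\<U>. Re (\<phi> z) > 0) \<and> \<phi> 0 = 1 \<and>
     deriv \<phi> 0 \<in> \<real> \<and> Re (deriv \<phi> 0) > 0 \<and> cnj ` (\<phi> ` \<U>) = \<phi> ` \<U>"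

definition class_C :: "(complex \<Rightarrow> complex) \<Rightarrow> (complex \<Rightarrow> complex) \<Rightarrow> (complex \<Rightarrow> complex) set" where
  "class_C g \<phi> = {f \<in> class_A.
     (\<lambda>z. g_deriv g (\<lambda>w. w * g_deriv g f w) z / g_deriv g f z) \<prec>\<^sub>s \<phi>}"

text \<open>The convention \<open>x / 0 = 0\<close> does not enlarge the class: since \<open>\<phi>\<close> has positive real
  part, the quotient is genuine at every point of the disc.\<close>

lemma class_C_g_deriv_nonzero:
  assumes "admissible_phi \<phi>" "f \<in> class_C g \<phi>" "z \<in> \<U>"
  shows "g_deriv g f z \<noteq> 0"
proof
  assume "g_deriv g f z = 0"
  moreover obtain u where u: "\<forall>z\<in>\<U>. cmod (u z) < 1 \<and>
      g_deriv g (\<lambda>w. w * g_deriv g f w) z / g_deriv g f z = \<phi> (u z)"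
    using assms(2) by (auto simp: class_C_def subordinate_def)
  ultimately have "\<phi> (u z) = 0" "u z \<in> \<U>"
    using assms(3) by (auto dest!: bspec)
  then show False
    using assms(1) by (auto simp: admissible_phi_def dest!: bspec)
qed

definition hankel_2_1 :: "(complex \<Rightarrow> complex) \<Rightarrow> complex" where
  "hankel_2_1 f = det (vector [vector [1, tcoeff f 2], vector [tcoeff f 2, tcoeff f 3]] :: complex^2^2)"

end

theory Submission
  imports Defs
begin

text \<open>
  Write \<open>h = D\<^sub>g f\<close>, so that \<open>h(z) = 1 + g\<^sub>2 a\<^sub>2 z + g\<^sub>3 a\<^sub>3 z\<^sup>2 + \<dots>\<close>. Applying \<open>D\<^sub>g\<close> to
  \<open>z h(z)\<close> multiplies these coefficients once more by \<open>g\<^sub>2, g\<^sub>3, \<dots>\<close>. Membership in the class says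
  that \<open>D\<^sub>g(z h) = (\<phi> \<circ> u) h\<close> for a Schwarz function \<open>u(z) = u\<^sub>1 z + u\<^sub>2 z\<^sup>2 + \<dots>\<close>, and comparing
  the coefficients of \<open>z\<close> and \<open>z\<^sup>2\<close> gives
  \<open>g\<^sub>2 (g\<^sub>2 - 1) a\<^sub>2 = B\<^sub>1 u\<^sub>1\<close> and
  \<open>g\<^sub>3 (g\<^sub>3 - 1) a\<^sub>3 = B\<^sub>1 u\<^sub>2 + B\<^sub>2 u\<^sub>1\<^sup>2 + B\<^sub>1 u\<^sub>1 g\<^sub>2 a\<^sub>2\<close>. Solving for \<open>a\<^sub>2\<close> and \<open>a\<^sub>3\<close> turns the
  Hankel determinant into \<open>B\<^sub>1 / (g\<^sub>3 (g\<^sub>3 - 1))\<close> times \<open>u\<^sub>2 + \<nu> u\<^sub>1\<^sup>2\<close>, where \<open>\<nu>\<close> is exactly the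
  number inside the maximum.

  What remains is the estimate \<open>|u\<^sub>2 + \<nu> u\<^sub>1\<^sup>2| \<le> max 1 |\<nu>|\<close>, which is
  \<open>schwarz_function_fekete_szego\<close>. It follows from \<open>|u\<^sub>2| \<le> 1 - |u\<^sub>1|\<^sup>2\<close>, because then
  \<open>|u\<^sub>2 + \<nu> u\<^sub>1\<^sup>2|\<close> is at most the convex combination \<open>(1 - |u\<^sub>1|\<^sup>2) + |\<nu>| |u\<^sub>1|\<^sup>2\<close>. The
  coefficient bound is the infinitesimal Schwarz--Pick inequality at the origin for \<open>u(z) / z\<close>.

  All identities between functions are read as identities between formal power series at the
  origin; the only convergence question is that a termwise product of convergent power series
  has positive radius of convergence.
\<close>

section \<open>Coefficient bounds for Schwarz functions\<close>

text \<open>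
  If \<open>|v|\<close> attains the value 1, the maximum modulus principle makes \<open>v\<close> constant. Otherwise
  the Moebius map that sends \<open>v 0\<close> to 0 carries \<open>v\<close> to a function to which the Schwarz lemma
  applies, and the derivative of that map at \<open>v 0\<close> is \<open>1 / (1 - |v 0|\<^sup>2)\<close>.
\<close>

lemma schwarz_pick_deriv_0:
  assumes hol: "v holomorphic_on ball 0 1"
    and le: "\<And>z. cmod z < 1 \<Longrightarrow> cmod (v z) \<le> 1"
  shows "cmod (deriv v 0) \<le> 1 - (cmod (v 0))\<^sup>2"
proof (cases "\<exists>z. cmod z < 1 \<and> cmod (v z) = 1")
  case True
  then obtain \<xi> where \<xi>: "cmod \<xi> < 1" "cmod (v \<xi>) = 1" by blast
  have "v constant_on ball 0 1"
    by (rule maximum_modulus_principle[OF hol, of "ball 0 1" \<xi>]) (use \<xi> le in auto)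
  then obtain c where c: "\<And>z. z \<in> ball 0 1 \<Longrightarrow> v z = c"
    by (auto simp: constant_on_def)
  have "deriv v 0 = deriv (\<lambda>_. c) 0"
    by (intro deriv_cong_ev eventually_nhds_in_open[of "ball 0 1", THEN eventually_mono])
       (use c in auto)
  then show ?thesis using le[of 0] by (simp add: power_le_one)
next
  case False
  then have lt: "\<And>z. cmod z < 1 \<Longrightarrow> cmod (v z) < 1"
    using le by force
  define c where "c = v 0"
  have c: "cmod c < 1" using lt[of 0] by (simp add: c_def)
  have c2: "1 - (cmod c)\<^sup>2 > 0"
    using c by (simp add: power_less_one_iff abs_square_less_1)
  \<comment> \<open>The Moebius denominator at \<open>z = 0\<close> is this positive real number, the one in the bound.\<close>
  have cc: "1 - cnj c * c = of_real (1 - (cmod c)\<^sup>2)"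
    using complex_norm_square[of c] by (simp add: mult.commute)
  have nz: "1 - cnj c * c \<noteq> 0"
    unfolding cc using c2 by (simp del: of_real_diff)
  define F where "F = (\<lambda>z. Moebius_function 0 c (v z))"
  have "(Moebius_function 0 c \<circ> v) holomorphic_on ball 0 1"
    by (rule holomorphic_on_compose_gen[OF hol Moebius_function_holomorphic[OF c]])
       (use lt in auto)
  then have F_hol: "F holomorphic_on ball 0 1" by (simp add: F_def comp_def)
  have "cmod (deriv F 0) \<le> 1"
    by (rule Schwarz_Lemma(2)[OF F_hol, of 0])
       (use lt c in \<open>auto simp: F_def c_def[symmetric] Moebius_function_eq_zero
          intro: Moebius_function_norm_lt_1\<close>)
  moreover have "deriv F 0 = deriv v 0 / (1 - cnj c * c)"
  proof (rule DERIV_imp_deriv)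
    have "(v has_field_derivative deriv v 0) (at 0)"
      by (rule holomorphic_derivI[OF hol]) auto
    then show "(F has_field_derivative deriv v 0 / (1 - cnj c * c)) (at 0)"
      using nz unfolding F_def Moebius_function_simple
      by (auto intro!: derivative_eq_intros simp: c_def[symmetric])
  qed
  moreover have "cmod (1 - cnj c * c) = 1 - (cmod c)\<^sup>2"
    unfolding cc using c2 by (simp del: of_real_diff)
  ultimately show ?thesis
    using c2 by (simp add: norm_divide c_def pos_divide_le_eq)
qed

text \<open>
  These coefficients of \<open>u\<close> are the value and the derivative at 0 of \<open>u(z) / z\<close>, which is bounded
  by 1 by the Schwarz lemma.
\<close>

lemma schwarz_function_second_coeff:
  assumes hol: "u holomorphic_on ball 0 1" and u0: "u 0 = 0"
    and lt: "\<And>z. cmod z < 1 \<Longrightarrow> cmod (u z) < 1"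
  shows "cmod (tcoeff u 2) \<le> 1 - (cmod (tcoeff u 1))\<^sup>2"
proof -
  obtain v where v: "v holomorphic_on ball 0 1" "\<And>z. cmod z < 1 \<Longrightarrow> u z = z * v z"
      "deriv u 0 = v 0"
    by (rule Schwarz3[OF hol u0], blast)
  have v_le: "cmod (v z) \<le> 1" if "cmod z < 1" for z
  proof (cases "z = 0")
    case True
    then show ?thesis using Schwarz_Lemma(2)[OF hol u0 lt that] v(3) by simp
  next
    case False
    then show ?thesis
      using Schwarz_Lemma(1)[OF hol u0 lt that] v(2)[OF that] by (simp add: norm_mult)
  qed
  have "v has_fps_expansion fps_expansion v 0"
    by (rule analytic_at_imp_has_fps_expansion_0)
       (use v(1) in \<open>auto simp: analytic_at intro!: exI[of _ "ball 0 1"]\<close>)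
  then have "(\<lambda>z. z * v z) has_fps_expansion fps_X * fps_expansion v 0"
    by (intro fps_expansion_intros)
  moreover have "eventually (\<lambda>z. z * v z = u z) (nhds 0)"
    by (rule eventually_nhds_in_open[of "ball 0 1", THEN eventually_mono]) (use v(2) in auto)
  ultimately have "u has_fps_expansion fps_X * fps_expansion v 0"
    by (rule iffD1[OF has_fps_expansion_cong[OF _ refl], rotated])
  then have U: "fps_expansion u 0 = fps_X * fps_expansion v 0"
    by (rule fps_expansion_eqI)
  have "tcoeff u 1 = v 0" "tcoeff u 2 = deriv v 0"
    unfolding U by (simp_all add: fps_expansion_def)
  then show ?thesis
    using schwarz_pick_deriv_0[OF v(1) v_le] by simp
qed

lemma schwarz_function_fekete_szego:
  assumes "u holomorphic_on ball 0 1" and "u 0 = 0"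
    and "\<And>z. cmod z < 1 \<Longrightarrow> cmod (u z) < 1"
  shows "cmod (tcoeff u 2 + \<nu> * (tcoeff u 1)\<^sup>2) \<le> max 1 (cmod \<nu>)"
proof -
  define t where "t = (cmod (tcoeff u 1))\<^sup>2"
  have u2: "cmod (tcoeff u 2) \<le> 1 - t"
    unfolding t_def by (rule schwarz_function_second_coeff[OF assms])
  have t: "0 \<le> t" "0 \<le> 1 - t"
    using order.trans[OF norm_ge_zero u2] by (simp_all add: t_def)
  have "cmod (tcoeff u 2 + \<nu> * (tcoeff u 1)\<^sup>2) \<le> cmod (tcoeff u 2) + cmod \<nu> * t"
    by (rule norm_triangle_le) (simp add: norm_mult norm_power t_def)
  also have "\<dots> \<le> (1 - t) * 1 + t * cmod \<nu>"
    using u2 by (simp add: mult.commute)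
  also have "\<dots> \<le> (1 - t) * max 1 (cmod \<nu>) + t * max 1 (cmod \<nu>)"
    using t by (intro add_mono mult_left_mono) auto
  finally show ?thesis by (simp add: algebra_simps)
qed

section \<open>Power series of the \<open>g\<close>-derivative\<close>

text \<open>
  The terms of one series are bounded and those of the other absolutely summable; consequently
  the radius of convergence of a Hadamard product is at least the product of the radii.
\<close>

lemma summable_hadamard_product:
  fixes F G :: "complex fps"
  assumes "ereal (cmod x) < fps_conv_radius F" "ereal (cmod y) < fps_conv_radius G"
  shows "summable (\<lambda>n. fps_nth F n * fps_nth G n * (x * y) ^ n)"
proof -
  have F: "summable (\<lambda>n. norm (fps_nth F n * x ^ n))"
    and G: "summable (\<lambda>n. norm (fps_nth G n * y ^ n))"
    using assms by (simp_all add: norm_summable_fps)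
  from G have "Bseq (\<lambda>n. fps_nth G n * y ^ n)"
    by (intro summable_imp_Bseq) (rule summable_norm_cancel)
  then obtain K where K: "\<And>n. norm (fps_nth G n * y ^ n) \<le> K"
    by (auto simp: Bseq_def)
  show ?thesis
  proof (rule summable_comparison_test')
    show "summable (\<lambda>n. norm (fps_nth F n * x ^ n) * K)"
      using F by (rule summable_mult2)
    show "norm (fps_nth F n * fps_nth G n * (x * y) ^ n) \<le> norm (fps_nth F n * x ^ n) * K"
      if "n \<ge> 0" for n
    proof -
      have "fps_nth F n * fps_nth G n * (x * y) ^ n = fps_nth F n * x ^ n * (fps_nth G n * y ^ n)"
        by (simp add: power_mult_distrib)
      then show ?thesis
        using mult_left_mono[OF K[of n], of "norm (fps_nth F n * x ^ n)"]
        by (simp only: norm_mult[of "fps_nth F n * x ^ n"] norm_ge_zero)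
    qed
  qed
qed

text \<open>
  The expansion is local at the origin so that the lemma can be iterated: it produces an expansion
  of \<open>D\<^sub>g f\<close>, hence one of \<open>z D\<^sub>g f(z)\<close>, which is the input for the second \<open>g\<close>-derivative. The
  constant term is 1 because \<open>D\<^sub>g\<close> takes the coefficients of \<open>z\<close> in both functions to be 1.
\<close>

lemma g_deriv_has_fps_expansion:
  assumes "g has_fps_expansion G" "f has_fps_expansion F"
  shows "g_deriv g f has_fps_expansion
    Abs_fps (\<lambda>n. if n = 0 then 1 else fps_nth G (Suc n) * fps_nth F (Suc n))"
    (is "_ has_fps_expansion ?H")
proof (rule has_fps_expansionI)
  have "0 < min (fps_conv_radius G) (fps_conv_radius F)"
    using assms by (simp add: has_fps_expansion_def)
  then obtain r where r: "0 < ereal r" "ereal r < min (fps_conv_radius G) (fps_conv_radius F)"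
    using ereal_dense2 by blast
  let ?c = "\<lambda>n. fps_nth G n * fps_nth F n"
  have "summable (\<lambda>n. ?c n * (complex_of_real r * complex_of_real r) ^ n)"
    by (rule summable_hadamard_product) (use r in auto)
  then have R: "conv_radius ?c \<ge> ereal (r * r)"
    using conv_radius_geI[of ?c "complex_of_real r * complex_of_real r"] r
    by (simp add: norm_mult)
  have sums: "(\<lambda>n. fps_nth ?H n * z ^ n) sums g_deriv g f z" if z: "cmod z < r * r" for z
  proof (cases "z = 0")
    case True
    have "(\<lambda>n. fps_nth ?H n * 0 ^ n) sums fps_nth ?H 0"
      by (rule powser_sums_zero)
    then show ?thesis using True by (simp add: g_deriv_def)
  next
    case False
    have "summable (\<lambda>n. ?c n * z ^ n)"
      by (rule summable_in_conv_radius, rule less_le_trans[OF _ R]) (use z in simp)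
    then have "summable (\<lambda>n. ?c (n + 2) * z ^ (n + 2))"
      by (rule summable_ignore_initial_segment)
    then have "summable (\<lambda>n. ?c (n + 2) * z ^ (n + 2) / z)"
      by (rule summable_divide)
    moreover have "?c (n + 2) * z ^ (n + 2) / z = ?c (n + 2) * z ^ (n + 1)" for n
      using False by (simp add: power_add power2_eq_square)
    ultimately have "summable (\<lambda>n. ?c (n + 2) * z ^ (n + 1))"
      by (simp only:)
    then have "(\<lambda>n. ?c (n + 2) * z ^ (n + 1)) sums (\<Sum>n. ?c (n + 2) * z ^ (n + 1))"
      by (rule summable_sums)
    then have "(\<lambda>n. fps_nth ?H (Suc n) * z ^ Suc n) sums (\<Sum>n. ?c (n + 2) * z ^ (n + 1))"
      by simp
    then have "(\<lambda>n. fps_nth ?H n * z ^ n) sums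
        ((\<Sum>n. ?c (n + 2) * z ^ (n + 1)) + fps_nth ?H 0 * z ^ 0)"
      by (rule sums_Suc)
    moreover have "(\<Sum>n. ?c (n + 2) * z ^ (n + 1)) + fps_nth ?H 0 * z ^ 0 = g_deriv g f z"
      unfolding g_deriv_def fps_expansion_eqI[OF assms(1)] fps_expansion_eqI[OF assms(2)]
      by simp
    ultimately show ?thesis by (simp only:)
  qed
  show "eventually (\<lambda>z. (\<lambda>n. fps_nth ?H n * z ^ n) sums g_deriv g f z) (nhds 0)"
    by (rule eventually_nhds_in_open[of "ball 0 (r * r)", THEN eventually_mono])
       (use r sums in auto)
qed

section \<open>The Hankel determinant\<close>

lemma holomorphic_on_disc_has_fps_expansion:
  assumes "f holomorphic_on \<U>"
  shows "f has_fps_expansion fps_expansion f 0"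
  by (rule analytic_at_imp_has_fps_expansion_0)
     (use assms in \<open>auto simp: analytic_at intro!: exI[of _ \<U>]\<close>)

text \<open>
  The series of \<open>D\<^sub>g(z D\<^sub>g f)\<close> is obtained in two ways: termwise from the definition of the
  \<open>g\<close>-derivative, and as the product of those of \<open>\<phi> \<circ> u\<close> and \<open>D\<^sub>g f\<close>. Since \<open>D\<^sub>g f\<close> has no zeros in
  the disc, multiplying the subordination by it is valid at every point.
\<close>

lemma class_C_coeffs:
  assumes g: "g \<in> class_A" and phi: "admissible_phi \<phi>" and f: "f \<in> class_C g \<phi>"
  obtains u where "u holomorphic_on \<U>" "u 0 = 0" "\<And>z. cmod z < 1 \<Longrightarrow> cmod (u z) < 1"
    "tcoeff g 2 * (tcoeff g 2 - 1) * tcoeff f 2 = tcoeff \<phi> 1 * tcoeff u 1"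
    "tcoeff g 3 * (tcoeff g 3 - 1) * tcoeff f 3 =
       tcoeff \<phi> 1 * tcoeff u 2 + tcoeff \<phi> 2 * (tcoeff u 1)\<^sup>2
       + tcoeff \<phi> 1 * tcoeff u 1 * tcoeff g 2 * tcoeff f 2"
proof -
  define h where "h = g_deriv g f"
  define N where "N = g_deriv g (\<lambda>w. w * h w)"
  obtain u where u: "u holomorphic_on \<U>" "u 0 = 0"
      "\<And>z. z \<in> \<U> \<Longrightarrow> cmod (u z) < 1" "\<And>z. z \<in> \<U> \<Longrightarrow> N z / h z = \<phi> (u z)"
    using f by (auto simp: class_C_def subordinate_def h_def N_def)
  define G where "G = fps_expansion g 0"
  define F where "F = fps_expansion f 0"
  define P where "P = fps_expansion \<phi> 0"
  define U where "U = fps_expansion u 0"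
  have G: "g has_fps_expansion G" and F: "f has_fps_expansion F"
    and P: "\<phi> has_fps_expansion P" and U: "u has_fps_expansion U"
    unfolding G_def F_def P_def U_def
    by (rule holomorphic_on_disc_has_fps_expansion,
        use g f phi u(1) in \<open>simp add: class_A_def class_C_def admissible_phi_def\<close>)+
  define H where "H = Abs_fps (\<lambda>n. if n = 0 then 1 else fps_nth G (Suc n) * fps_nth F (Suc n))"
  have H: "h has_fps_expansion H"
    unfolding h_def H_def by (rule g_deriv_has_fps_expansion[OF G F])
  have XH: "(\<lambda>w. w * h w) has_fps_expansion fps_X * H"
    by (intro fps_expansion_intros H)
  define K where
    "K = Abs_fps (\<lambda>n. if n = 0 then 1 else fps_nth G (Suc n) * fps_nth (fps_X * H) (Suc n))"
  have "N has_fps_expansion K"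
    unfolding N_def K_def by (rule g_deriv_has_fps_expansion[OF G XH])
  moreover
  have P0: "fps_nth P 0 = 1" and U0: "fps_nth U 0 = 0"
    using phi u(2) by (simp_all add: P_def U_def fps_expansion_def admissible_phi_def)
  have "N has_fps_expansion (P oo U) * H"
  proof -
    have "(\<lambda>z. (\<phi> \<circ> u) z * h z) has_fps_expansion (P oo U) * H"
      by (intro has_fps_expansion_mult has_fps_expansion_compose P U U0 H)
    moreover have "eventually (\<lambda>z. (\<phi> \<circ> u) z * h z = N z) (nhds 0)"
    proof (rule eventually_nhds_in_open[of \<U>, THEN eventually_mono])
      fix z assume z: "z \<in> \<U>"
      then have "h z \<noteq> 0"
        unfolding h_def by (rule class_C_g_deriv_nonzero[OF phi f])
      then show "(\<phi> \<circ> u) z * h z = N z"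
        using u(4)[OF z] by (simp add: field_simps)
    qed auto
    ultimately show ?thesis
      by (rule iffD1[OF has_fps_expansion_cong[OF _ refl], rotated])
  qed
  ultimately have eq: "K = (P oo U) * H"
    by (rule fps_expansion_unique_complex)
  have PU: "fps_nth (P oo U) 1 = fps_nth P 1 * fps_nth U 1"
      "fps_nth (P oo U) 2 = fps_nth P 1 * fps_nth U 2 + fps_nth P 2 * (fps_nth U 1)\<^sup>2"
    by (simp_all add: fps_compose_nth numeral_2_eq_2 fps_mult_nth U0 power2_eq_square)
  have 1: "fps_nth G 2 * (fps_nth G 2 * fps_nth F 2)
      = fps_nth P 1 * fps_nth U 1 + fps_nth G 2 * fps_nth F 2"
  proof -
    have "fps_nth K 1 = fps_nth G 2 * (fps_nth G 2 * fps_nth F 2)"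
      by (simp add: K_def H_def numeral_2_eq_2)
    moreover have "fps_nth ((P oo U) * H) 1 = fps_nth P 1 * fps_nth U 1 + fps_nth G 2 * fps_nth F 2"
      using PU P0 by (simp add: fps_mult_nth H_def numeral_2_eq_2)
    ultimately show ?thesis using eq by simp
  qed
  have 2: "fps_nth G 3 * (fps_nth G 3 * fps_nth F 3)
      = fps_nth P 1 * fps_nth U 2 + fps_nth P 2 * (fps_nth U 1)\<^sup>2
        + fps_nth P 1 * fps_nth U 1 * (fps_nth G 2 * fps_nth F 2) + fps_nth G 3 * fps_nth F 3"
  proof -
    have "fps_nth K 2 = fps_nth G 3 * (fps_nth G 3 * fps_nth F 3)"
      by (simp add: K_def H_def numeral_2_eq_2 numeral_3_eq_3)
    moreover have "fps_nth ((P oo U) * H) 2 =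
        fps_nth P 1 * fps_nth U 2 + fps_nth P 2 * (fps_nth U 1)\<^sup>2
        + fps_nth P 1 * fps_nth U 1 * (fps_nth G 2 * fps_nth F 2) + fps_nth G 3 * fps_nth F 3"
      using PU P0 by (simp add: fps_mult_nth H_def numeral_2_eq_2 numeral_3_eq_3)
    ultimately show ?thesis using eq by simp
  qed
  show ?thesis
  proof (rule that[of u])
    show "tcoeff g 2 * (tcoeff g 2 - 1) * tcoeff f 2 = tcoeff \<phi> 1 * tcoeff u 1"
      using 1 unfolding G_def F_def P_def U_def by (simp add: algebra_simps)
    show "tcoeff g 3 * (tcoeff g 3 - 1) * tcoeff f 3 =
       tcoeff \<phi> 1 * tcoeff u 2 + tcoeff \<phi> 2 * (tcoeff u 1)\<^sup>2
       + tcoeff \<phi> 1 * tcoeff u 1 * tcoeff g 2 * tcoeff f 2"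
      using 2 unfolding G_def F_def P_def U_def by (simp add: algebra_simps)
  qed (use u in auto)
qed

theorem theorem3p15:
  fixes f g \<phi> :: "complex \<Rightarrow> complex" and g2 g3 B1 B2 :: complex
  defines "g2 \<equiv> tcoeff g 2" and "g3 \<equiv> tcoeff g 3"
    and "B1 \<equiv> tcoeff \<phi> 1" and "B2 \<equiv> tcoeff \<phi> 2"
  assumes g: "g \<in> class_A"
    and phi: "admissible_phi \<phi>"
    and f: "f \<in> class_C g \<phi>"
    and g2: "g2 \<noteq> 0" "g2 \<noteq> 1"
    and g3: "g3 \<noteq> 0" "g3 \<noteq> 1"
  shows "cmod (hankel_2_1 f) \<le>
    Re B1 / cmod (g3 * (g3 - 1)) *
      max 1 (cmod (B2 / B1 + B1 / (g2 - 1) * (1 - g3 * (g3 - 1) / (g2\<^sup>2 * (g2 - 1)))))"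
proof -
  define a2 where "a2 = tcoeff f 2"
  define a3 where "a3 = tcoeff f 3"
  obtain u where u: "u holomorphic_on \<U>" "u 0 = 0" "\<And>z. cmod z < 1 \<Longrightarrow> cmod (u z) < 1"
    and e2: "g2 * (g2 - 1) * a2 = B1 * tcoeff u 1"
    and e3: "g3 * (g3 - 1) * a3 = B1 * tcoeff u 2 + B2 * (tcoeff u 1)\<^sup>2
       + B1 * tcoeff u 1 * g2 * a2"
    using class_C_coeffs[OF g phi f]
    unfolding g2_def g3_def B1_def B2_def a2_def a3_def by blast
  define u1 where "u1 = tcoeff u 1"
  define u2 where "u2 = tcoeff u 2"
  define \<nu> where "\<nu> = B2 / B1 + B1 / (g2 - 1) * (1 - g3 * (g3 - 1) / (g2\<^sup>2 * (g2 - 1)))"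
  have B1_deriv: "B1 = deriv \<phi> 0"
    by (simp add: B1_def fps_expansion_def)
  have B1: "Re B1 > 0" "B1 = complex_of_real (Re B1)"
    using phi unfolding B1_deriv by (auto simp: admissible_phi_def)
  then have B1_cmod: "cmod B1 = Re B1"
    by (metis norm_of_real abs_of_pos)
  have B1_nz: "B1 \<noteq> 0" using B1(1) by auto
  have d: "g2 - 1 \<noteq> 0" "g3 - 1 \<noteq> 0" using g2 g3 by auto
  have ea2: "a2 = B1 * u1 / (g2 * (g2 - 1))"
    using e2 g2 d by (simp add: u1_def field_simps)
  have "g3 * (g3 - 1) * a3 = B1 * u2 + B2 * u1\<^sup>2 + B1\<^sup>2 * u1\<^sup>2 / (g2 - 1)"
    unfolding e3 ea2 using g2 d by (simp add: u1_def u2_def power2_eq_square)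
  then have ea3: "a3 = (B1 * u2 + B2 * u1\<^sup>2 + B1\<^sup>2 * u1\<^sup>2 / (g2 - 1)) / (g3 * (g3 - 1))"
    using g3 d by (simp add: eq_divide_eq mult.commute)
  have "hankel_2_1 f = a3 - a2\<^sup>2"
    by (simp add: hankel_2_1_def det_2 a2_def a3_def power2_eq_square)
  also have "\<dots> = B1 / (g3 * (g3 - 1)) * (u2 + \<nu> * u1\<^sup>2)"
  proof -
    define p q where "p = g2 - 1" and "q = g3 * (g3 - 1)"
    have "p \<noteq> 0" "q \<noteq> 0" using d g3 by (auto simp: p_def q_def)
    then have "B1 * \<nu> = B2 + B1\<^sup>2 / p - q * (B1\<^sup>2 / (g2\<^sup>2 * p\<^sup>2))"
      unfolding \<nu>_def p_def[symmetric] q_def[symmetric] using B1_nz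
      by (simp add: distrib_left right_diff_distrib power2_eq_square mult_ac)
    then have "B1 / q * (u2 + \<nu> * u1\<^sup>2)
        = (B1 * u2 + (B2 + B1\<^sup>2 / p - q * (B1\<^sup>2 / (g2\<^sup>2 * p\<^sup>2))) * u1\<^sup>2) / q"
      by (simp add: distrib_left add_divide_distrib flip: mult.assoc)
    also have "\<dots> = (B1 * u2 + B2 * u1\<^sup>2 + B1\<^sup>2 * u1\<^sup>2 / p) / q - (B1 * u1 / (g2 * p))\<^sup>2"
      using \<open>q \<noteq> 0\<close>
      by (simp add: distrib_right left_diff_distrib add_divide_distrib diff_divide_distrib
          power_mult_distrib power_divide)
    finally show ?thesis
      unfolding ea2 ea3 p_def[symmetric] q_def[symmetric] by (rule sym)
  qed
  finally have "cmod (hankel_2_1 f) = Re B1 / cmod (g3 * (g3 - 1)) * cmod (u2 + \<nu> * u1\<^sup>2)"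
    by (simp add: norm_mult norm_divide B1_cmod)
  also have "\<dots> \<le> Re B1 / cmod (g3 * (g3 - 1)) * max 1 (cmod \<nu>)"
    unfolding u1_def u2_def
    by (intro mult_left_mono schwarz_function_fekete_szego u) (use B1(1) in auto)
  finally show ?thesis unfolding \<nu>_def .
qed

end
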